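(* Let $r,p,k$ be positive integers with $p\le r$ such that $f(r,p,k)$ exists. Then $$f(n,r,p,k)\ge \binom np\binom{f(r,p,k)}{p}^{-1}(1-o(1)),$$ where $r,p,k$ are fixed and the $o(1)$ term tends to $0$ as $n\to\infty$.
   Context: $H(n,r)$ is the complete $r$-uniform hypergraph on $n$ vertices. An orientation assigns to each edge a linear ordering of its $r$ vertices (positions $1,\dots,r$). Let $P_1,\dots,P_{\binom rp}$ be the $p$-subsets of $\{1,\dots,r\}$; for a $p$-set $A$, $d_i(A)$ is the number of edges $E\supseteq A$ in which $A$ occupies exactly the positions $P_i$. $f(n,r,p,k)$ is the minimum, over all orientations of $H(n,r)$, of the number of $p$-sets $A$ with $d_i(A)\ge k$ for all $i$. $f(r,p,k)=\min\{n: f(n,r,p,k)>0\}$. *)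

theory Defs
  imports Complex_Main "HOL-Library.FuncSet" "HOL-Library.Ramsey"
    "HOL-Combinatorics.Multiset_Permutations"
begin

text \<open>The hypergraph \<open>H(n,r)\<close> has vertex set \<open>{1..n}\<close>, and its edges are the elements of
  \<open>[{1..n}]\<^bsup>r\<^esup>\<close> (constant \<open>nsets\<close>). A linear ordering of a finite set is encoded as a distinct
  list enumerating it.\<close>

definition orientations :: "nat \<Rightarrow> nat \<Rightarrow> (nat set \<Rightarrow> nat list) set" where
  "orientations n r = (\<Pi>\<^sub>E E \<in> [{1..n}]\<^bsup>r\<^esup>. permutations_of_set E)"

text \<open>Positions are numbered from 1, hence the shift in the list index.\<close>

definition positions :: "'a list \<Rightarrow> 'a set \<Rightarrow> nat set" where
  "positions xs A = {i \<in> {1..length xs}. xs ! (i - 1) \<in> A}"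

text \<open>The quantity \<open>d\<^sub>i(A)\<close>, indexed by the position set \<open>P = P\<^sub>i\<close> itself instead of its number
  in an enumeration.\<close>

definition pos_degree ::
    "nat \<Rightarrow> nat \<Rightarrow> (nat set \<Rightarrow> nat list) \<Rightarrow> nat set \<Rightarrow> nat set \<Rightarrow> nat" where
  "pos_degree n r \<omega> P A = card {E \<in> [{1..n}]\<^bsup>r\<^esup>. A \<subseteq> E \<and> positions (\<omega> E) A = P}"

definition rich_sets ::
    "nat \<Rightarrow> nat \<Rightarrow> nat \<Rightarrow> nat \<Rightarrow> (nat set \<Rightarrow> nat list) \<Rightarrow> nat set set" where
  "rich_sets n r p k \<omega> =
     {A \<in> [{1..n}]\<^bsup>p\<^esup>. \<forall>P \<in> [{1..r}]\<^bsup>p\<^esup>. k \<le> pos_degree n r \<omega> P A}"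

definition f_min :: "nat \<Rightarrow> nat \<Rightarrow> nat \<Rightarrow> nat \<Rightarrow> nat" where
  "f_min n r p k = Min ((\<lambda>\<omega>. card (rich_sets n r p k \<omega>)) ` orientations n r)"

lemma finite_orientations: "finite (orientations n r)"
  unfolding orientations_def by (intro finite_PiE finite_imp_finite_nsets) auto

lemma orientations_nonempty: "orientations n r \<noteq> {}"
  unfolding orientations_def by (auto simp: PiE_eq_empty_iff nsets_def)

text \<open>Meaningful only if some \<open>n\<close> satisfies \<open>f_min n r p k > 0\<close>.\<close>

definition f_threshold :: "nat \<Rightarrow> nat \<Rightarrow> nat \<Rightarrow> nat" where
  "f_threshold r p k = (LEAST n. f_min n r p k > 0)"

end

theory Submission imports Defs begin

text \<open>Put \<open>m = f_threshold r p k\<close>. An orientation of \<open>H(n,r)\<close> induces one on every \<open>m\<close>-subset of the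
  vertices, which contains a rich \<open>p\<close>-set by the choice of \<open>m\<close>; passing to the full vertex set only
  increases the degrees, so this \<open>p\<close>-set stays rich. Each \<open>p\<close>-set lies in \<open>(n - p) choose (m - p)\<close> of
  the \<open>m\<close>-subsets, so double counting gives the bound for all \<open>n \<ge> m\<close> without any error term.\<close>

lemma positions_map_image:
  assumes "inj_on h (set xs)" and "A \<subseteq> set xs"
  shows "positions (map h xs) (h ` A) = positions xs A"
proof -
  have "map h xs ! (i - 1) \<in> h ` A \<longleftrightarrow> xs ! (i - 1) \<in> A" if "i \<in> {1..length xs}" for i
  proof -
    have "i - 1 < length xs" using that by auto
    then show ?thesis using inj_on_image_mem_iff[OF assms(1) _ assms(2)] by simp
  qed
  then show ?thesis
    unfolding positions_def length_map by (intro Collect_cong conj_cong refl)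
qed

lemma image_in_nsets:
  assumes "inj_on g S" and "g ` S \<subseteq> T" and "A \<in> [S]\<^bsup>p\<^esup>"
  shows "g ` A \<in> [T]\<^bsup>p\<^esup>"
  using assms by (auto simp: nsets_def card_image inj_on_subset)

lemma orientations_edge:
  assumes "\<omega> \<in> orientations n r" and "E \<in> [{1..n}]\<^bsup>r\<^esup>"
  shows "set (\<omega> E) = E" and "distinct (\<omega> E)"
  using assms by (auto simp: orientations_def PiE_iff permutations_of_set_def)

definition pullback :: "nat \<Rightarrow> nat \<Rightarrow> (nat \<Rightarrow> nat) \<Rightarrow> (nat set \<Rightarrow> nat list) \<Rightarrow> nat set \<Rightarrow> nat list" where
  "pullback m r g \<omega> =
     (\<lambda>E \<in> [{1..m}]\<^bsup>r\<^esup>. map (the_inv_into {1..m} g) (\<omega> (g ` E)))"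

context
  fixes g :: "nat \<Rightarrow> nat" and m n r :: nat and \<omega> :: "nat set \<Rightarrow> nat list"
  assumes inj: "inj_on g {1..m}" and sub: "g ` {1..m} \<subseteq> {1..n}"
    and \<omega>: "\<omega> \<in> orientations n r"
begin

lemma the_inv_into_image:
  assumes "A \<subseteq> {1..m}"
  shows "the_inv_into {1..m} g ` g ` A = A"
proof -
  have "the_inv_into {1..m} g (g x) = x" if "x \<in> A" for x
    using inj assms that by (intro the_inv_into_f_f) auto
  then show ?thesis by (simp add: image_image)
qed

lemma inj_on_the_inv_into_image:
  assumes "A \<subseteq> {1..m}"
  shows "inj_on (the_inv_into {1..m} g) (g ` A)"
  using inj_on_the_inv_into[OF inj] assms by (meson image_mono inj_on_subset)

lemma pullback_in_orientations: "pullback m r g \<omega> \<in> orientations m r"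
  unfolding orientations_def pullback_def
proof (rule restrict_PiE_iff[THEN iffD2], intro ballI)
  fix E assume E: "E \<in> [{1..m}]\<^bsup>r\<^esup>"
  then have "E \<subseteq> {1..m}" by (simp add: nsets_def)
  then show "map (the_inv_into {1..m} g) (\<omega> (g ` E)) \<in> permutations_of_set E"
    using orientations_edge[OF \<omega> image_in_nsets[OF inj sub E]]
      the_inv_into_image[of E] inj_on_the_inv_into_image[of E]
    by (simp add: permutations_of_set_def distinct_map)
qed

text \<open>Taking images under \<open>g\<close> embeds the edges counted on the left into those
  counted on the right. Equality can fail because edges through \<open>g\<close>
  A\<open>may leave\<close>g \<open>{1..m}\<close>.\<close>

lemma pos_degree_pullback_le:
  assumes A: "A \<subseteq> {1..m}"
  shows "pos_degree m r (pullback m r g \<omega>) P A \<le> pos_degree n r \<omega> P (g ` A)"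
  unfolding pos_degree_def
proof (rule card_inj_on_le[where f = "(`) g"])
  show "inj_on ((`) g) {E \<in> [{1..m}]\<^bsup>r\<^esup>. A \<subseteq> E \<and> positions (pullback m r g \<omega> E) A = P}"
    by (rule inj_on_subset[OF inj_on_image_Pow[OF inj]]) (auto simp: nsets_def)
  show "(`) g ` {E \<in> [{1..m}]\<^bsup>r\<^esup>. A \<subseteq> E \<and> positions (pullback m r g \<omega> E) A = P}
      \<subseteq> {E \<in> [{1..n}]\<^bsup>r\<^esup>. g ` A \<subseteq> E \<and> positions (\<omega> E) (g ` A) = P}"
  proof (rule image_subsetI)
    fix E assume E: "E \<in> {E \<in> [{1..m}]\<^bsup>r\<^esup>. A \<subseteq> E \<and> positions (pullback m r g \<omega> E) A = P}"
    then have gE: "g ` E \<in> [{1..n}]\<^bsup>r\<^esup>" and Em: "E \<subseteq> {1..m}" and AE: "A \<subseteq> E"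
      using image_in_nsets[OF inj sub] by (auto simp: nsets_def)
    \<comment> \<open>\<open>A\<close> is written as the inverse image of \<open>g\<close>
      A\<open>, so that the relabelling lemma applies to the list\<close>\<omega> (g
      \<open>E)\<close>.\<close>
    have "positions (map (the_inv_into {1..m} g) (\<omega> (g ` E))) (the_inv_into {1..m} g ` g ` A)
        = positions (\<omega> (g ` E)) (g ` A)"
      using AE orientations_edge[OF \<omega> gE] inj_on_the_inv_into_image[OF Em]
      by (intro positions_map_image) auto
    then show "g ` E \<in> {E \<in> [{1..n}]\<^bsup>r\<^esup>. g ` A \<subseteq> E \<and> positions (\<omega> E) (g ` A) = P}"
      using E gE AE the_inv_into_image[OF A] by (auto simp: pullback_def)
  qed
  show "finite {E \<in> [{1..n}]\<^bsup>r\<^esup>. g ` A \<subseteq> E \<and> positions (\<omega> E) (g ` A) = P}"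
    by (simp add: finite_imp_finite_nsets)
qed

lemma image_in_rich_sets:
  assumes "A \<in> rich_sets m r p k (pullback m r g \<omega>)"
  shows "g ` A \<in> rich_sets n r p k \<omega>"
proof -
  have A: "A \<in> [{1..m}]\<^bsup>p\<^esup>" using assms by (simp add: rich_sets_def)
  then have "A \<subseteq> {1..m}" by (simp add: nsets_def)
  then have "k \<le> pos_degree n r \<omega> P (g ` A)" if "P \<in> [{1..r}]\<^bsup>p\<^esup>" for P
    using assms that pos_degree_pullback_le[of A P] by (force simp: rich_sets_def)
  then show ?thesis
    using image_in_nsets[OF inj sub A] by (simp add: rich_sets_def)
qed

end

lemma f_min_le:
  "\<omega> \<in> orientations n r \<Longrightarrow> f_min n r p k \<le> card (rich_sets n r p k \<omega>)"
  by (simp add: f_min_def finite_orientations)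

lemma f_min_attained:
  obtains \<omega> where "\<omega> \<in> orientations n r" and "f_min n r p k = card (rich_sets n r p k \<omega>)"
  using Min_in[of "(\<lambda>\<omega>. card (rich_sets n r p k \<omega>)) ` orientations n r"]
    finite_orientations orientations_nonempty unfolding f_min_def by blast

lemma rich_sets_nonempty:
  assumes "f_min m r p k > 0" and "\<omega> \<in> orientations m r"
  shows "rich_sets m r p k \<omega> \<noteq> {}"
  using f_min_le[OF assms(2), of p k] assms(1) by auto

text \<open>A rich set is a \<open>p\<close>-subset of \<open>{1..m}\<close>. This keeps
  \<open>m - p\<close> from truncating and makes \<open>m choose p\<close> positive.\<close>

lemma f_min_pos_imp_le:
  assumes "f_min m r p k > 0"
  shows "p \<le> m"
proof -
  obtain \<omega> where "\<omega> \<in> orientations m r" using orientations_nonempty by blast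
  then obtain A where "A \<in> rich_sets m r p k \<omega>"
    using rich_sets_nonempty[OF assms] by blast
  then have "A \<subseteq> {1..m}" "card A = p" by (auto simp: rich_sets_def nsets_def)
  then show ?thesis using card_mono[of "{1..m}" A] by simp
qed

lemma subset_contains_rich_set:
  assumes "f_min m r p k > 0" and "\<omega> \<in> orientations n r" and "M \<in> [{1..n}]\<^bsup>m\<^esup>"
  shows "\<exists>A \<in> rich_sets n r p k \<omega>. A \<subseteq> M"
proof -
  have M: "M \<subseteq> {1..n}" "finite M" "card M = m" using assms(3) by (auto simp: nsets_def)
  \<comment> \<open>Numbering the vertices of \<open>M\<close> lets positivity of
    \<open>f_min m r p k\<close> be applied to the pulled-back orientation.\<close>
  then obtain g where g: "bij_betw g {1..m} M"
    using finite_same_card_bij[of "{1..m}" M] by auto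
  then have inj: "inj_on g {1..m}" and sub: "g ` {1..m} \<subseteq> {1..n}"
    using M by (auto simp: bij_betw_def)
  obtain A where A: "A \<in> rich_sets m r p k (pullback m r g \<omega>)"
    using rich_sets_nonempty[OF assms(1) pullback_in_orientations[OF inj sub assms(2)]] by blast
  then have "g ` A \<subseteq> M"
    using g by (auto simp: rich_sets_def nsets_def bij_betw_def)
  then show ?thesis
    using image_in_rich_sets[OF inj sub assms(2) A] by blast
qed

lemma card_nsets_superset:
  assumes "finite S" and "A \<in> [S]\<^bsup>p\<^esup>" and "p \<le> m"
  shows "card {M \<in> [S]\<^bsup>m\<^esup>. A \<subseteq> M} = (card S - p) choose (m - p)"
proof -
  have A: "A \<subseteq> S" "finite A" "card A = p" using assms(2) by (auto simp: nsets_def)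
  \<comment> \<open>A superset of \<open>A\<close> is determined by its part outside
    \<open>A\<close>.\<close>
  have "bij_betw (\<lambda>B. A \<union> B) ([S - A]\<^bsup>(m - p)\<^esup>) {M \<in> [S]\<^bsup>m\<^esup>. A \<subseteq> M}"
  proof (rule bij_betw_byWitness[where f' = "\<lambda>M. M - A"])
    show "(\<lambda>B. A \<union> B) ` [S - A]\<^bsup>(m - p)\<^esup> \<subseteq> {M \<in> [S]\<^bsup>m\<^esup>. A \<subseteq> M}"
    proof (rule image_subsetI)
      fix B assume "B \<in> [S - A]\<^bsup>(m - p)\<^esup>"
      then have B: "B \<subseteq> S - A" "finite B" "card B = m - p" by (auto simp: nsets_def)
      then have "card (A \<union> B) = m"
        using A assms(3) by (subst card_Un_disjoint) auto
      then show "A \<union> B \<in> {M \<in> [S]\<^bsup>m\<^esup>. A \<subseteq> M}" using A B by (auto simp: nsets_def)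
    qed
  qed (use A in \<open>auto simp: nsets_def card_Diff_subset\<close>)
  then have "card {M \<in> [S]\<^bsup>m\<^esup>. A \<subseteq> M} = card ([S - A]\<^bsup>(m - p)\<^esup>)"
    by (rule bij_betw_same_card[symmetric])
  then show ?thesis using A by (simp add: card_Diff_subset)
qed

lemma choose_le_f_min:
  assumes "f_min m r p k > 0" and "m \<le> n"
  shows "n choose p \<le> f_min n r p k * (m choose p)"
proof -
  obtain \<omega> where \<omega>: "\<omega> \<in> orientations n r"
    and f_eq: "f_min n r p k = card (rich_sets n r p k \<omega>)"
    by (rule f_min_attained)
  define R where "R = rich_sets n r p k \<omega>"
  have pm: "p \<le> m" by (rule f_min_pos_imp_le[OF assms(1)])
  have finN: "finite ([{1..n}]\<^bsup>m\<^esup>)" by (simp add: finite_imp_finite_nsets)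
  have RN: "R \<subseteq> [{1..n}]\<^bsup>p\<^esup>" by (auto simp: R_def rich_sets_def)
  then have finR: "finite R" by (rule finite_subset) (simp add: finite_imp_finite_nsets)
  \<comment> \<open>Pairs \<open>A \<subseteq> M\<close> with \<open>A\<close> in \<open>R\<close>
    are counted: first by \<open>M\<close>, each contributing at least one, then by
    \<open>A\<close>, each contributing equally.\<close>
  have "n choose m = (\<Sum>M \<in> [{1..n}]\<^bsup>m\<^esup>. 1)" by simp
  also have "\<dots> \<le> (\<Sum>M \<in> [{1..n}]\<^bsup>m\<^esup>. card {A \<in> R. A \<subseteq> M})"
  proof (rule sum_mono)
    fix M assume "M \<in> [{1..n}]\<^bsup>m\<^esup>"
    then have "{A \<in> R. A \<subseteq> M} \<noteq> {}"
      using subset_contains_rich_set[OF assms(1) \<omega>] by (auto simp: R_def)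
    then show "1 \<le> card {A \<in> R. A \<subseteq> M}" using finR by (simp add: Suc_le_eq card_gt_0_iff)
  qed
  also have "\<dots> = ((n - p) choose (m - p)) * card R"
    using RN pm card_nsets_superset[of "{1..n}" _ p m]
    by (intro sum_multicount[OF finN finR]) auto
  \<comment> \<open>The factor \<open>m choose p\<close> is chosen so that
    \<open>choose_mult\<close> turns the left side into \<open>n choose p\<close> times
    \<open>(n - p) choose (m - p)\<close>; this last factor is then cancelled.\<close>
  finally have "(n choose m) * (m choose p) \<le> ((n - p) choose (m - p)) * card R * (m choose p)"
    by (rule mult_right_mono) simp
  then have "(n choose p) * ((n - p) choose (m - p))
      \<le> (card R * (m choose p)) * ((n - p) choose (m - p))"
    using choose_mult[OF pm assms(2)] by (simp only: mult_ac)
  moreover have "0 < (n - p) choose (m - p)"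
    using assms(2) by (simp add: zero_less_binomial)
  ultimately show ?thesis by (simp add: f_eq R_def)
qed

theorem theorem14:
  fixes r p k :: nat
  assumes "r > 0" and "p > 0" and "k > 0" and "p \<le> r"
    and "\<exists>n. f_min n r p k > 0"
  shows "\<exists>\<epsilon> :: nat \<Rightarrow> real. \<epsilon> \<longlonglongrightarrow> 0 \<and>
    (\<forall>n. real (f_min n r p k) \<ge>
       real (n choose p) * inverse (real (f_threshold r p k choose p)) * (1 - \<epsilon> n))"
proof -
  define m where "m = f_threshold r p k"
  \<comment> \<open>The value 1 makes the bound trivially 0 for the finitely many
    \<open>n < m\<close>; from \<open>m\<close> on the error is exactly 0.\<close>
  define \<epsilon> :: "nat \<Rightarrow> real" where "\<epsilon> n = (if n < m then 1 else 0)" for n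
  have pos: "f_min m r p k > 0"
    unfolding m_def f_threshold_def using assms(5) by (rule LeastI_ex)
  have "m choose p > 0"
    using f_min_pos_imp_le[OF pos] by (simp add: zero_less_binomial)
  have "\<epsilon> \<longlonglongrightarrow> 0"
    by (rule tendsto_eventually) (auto simp: \<epsilon>_def eventually_sequentially intro!: exI[of _ m])
  moreover have "real (n choose p) * inverse (real (m choose p)) * (1 - \<epsilon> n)
      \<le> real (f_min n r p k)" for n
  proof (cases "n < m")
    case False
    then have "real (n choose p) \<le> real (f_min n r p k) * real (m choose p)"
      using choose_le_f_min[OF pos, of n] by (simp flip: of_nat_mult)
    then show ?thesis
      using False \<open>m choose p > 0\<close> by (simp add: \<epsilon>_def field_simps)
  qed (simp add: \<epsilon>_def)
  ultimately show ?thesis unfolding m_def by blast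
qed

end
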